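(* Let $T=z^4+p_2z^2+p_0$ and $Q=z^2+q_1z+q_0$ define the torus $\mathcal{T}$ and the quadric $\mathcal{Q}$ as in the context. Let $(x_0,y_0,z_0)$ be a singular point of $\mathcal{C}_{\mathbb{R}}=\mathcal{T}\cap\mathcal{Q}$ with $z_0\neq 0$. Then $(x_0,y_0)$ is a singularity of the plane curve defined by $\mathbf{S}_0$.
   Context: Fix real numbers $0<r<R$. Put $p_2(x,y)=2(R^2-r^2+x^2+y^2)$, $p_0(x,y)=(R^2+2Rr+r^2-x^2-y^2)(R^2-2Rr+r^2-x^2-y^2)$, $T=z^4+p_2z^2+p_0\in\mathbb{R}[x,y,z]$, and $\mathcal{T}=\{T=0\}\subset\mathbb{R}^3$ (a ring torus). Let $q_1=ex+fy+i$ and $q_0=ax^2+by^2+dxy+gx+hy+j$ with real coefficients, $Q=z^2+q_1z+q_0$, and $\mathcal{Q}=\{Q=0\}\subset\mathbb{R}^3$. Standing assumption: the quadric is irreducible, i.e. neither the square of a plane nor the union of two planes. $\widetilde{\mathbf{S}_0}\in\mathbb{R}[x,y]$ is the resultant of $T$ and $Q$ with respect to $z$, explicitly $\widetilde{\mathbf{S}_0}=(q_0q_1^2+p_2q_0-q_0^2-p_0)^2+q_1^2(q_1^2+p_2-2q_0)(p_0-q_0^2)$; $\widehat{\mathbf{S}_0}$ is its squarefree part; and $\mathbf{S}_0=\widehat{\mathbf{S}_0}/\gcd(\widehat{\mathbf{S}_0},\,p_2+q_1^2-2q_0)$. Singular point of a real plane curve: a point of the curve where both partial derivatives of the squarefree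 polynomial defining the curve (here $\mathbf{S}_0$) vanish. Singular points of $\mathcal{C}_{\mathbb{R}}$: let $I(\mathcal{C}_{\mathbb{R}})=\{F\in\mathbb{R}[x,y,z]: F|_{\mathcal{C}_{\mathbb{R}}}=0\}$. A point of $\mathcal{C}_{\mathbb{R}}$ is singular if the Jacobian matrix of a system of generators of $I(\mathcal{C}_{\mathbb{R}})$ has rank $0$ or $1$ at the point, and regular if the rank is $2$. Isolated points of $\mathcal{C}_{\mathbb{R}}$ (in the Euclidean topology) are regarded as singular. *)

theory Defs
  imports
    "HOL-Analysis.Analysis"
    "HOL-Computational_Algebra.Computational_Algebra"
    "HOL-Computational_Algebra.Field_as_Ring"
    "Subresultants.Resultant_Prelim"
begin

section \<open>Polynomials in two and three variables\<close>

text \<open>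
  The ring of real polynomials in \<open>x, y\<close> is \<^typ>\<open>real poly poly\<close>, with \<open>y\<close> the outer variable;
  the ring in \<open>x, y, z\<close> is \<^typ>\<open>real poly poly poly\<close>, with \<open>z\<close> the outermost variable. Thus
  \<^const>\<open>resultant\<close> on the latter type eliminates \<open>z\<close>.
\<close>

definition const2 :: "real \<Rightarrow> real poly poly" where
  "const2 c = [:[:c:]:]"

definition X2 :: "real poly poly" where
  "X2 = [:[:0, 1:]:]"

definition Y2 :: "real poly poly" where
  "Y2 = [:0, 1:]"

definition eval2 :: "real poly poly \<Rightarrow> real \<times> real \<Rightarrow> real" where
  "eval2 P = (\<lambda>(x, y). poly (poly P [:y:]) x)"

definition eval3 :: "real poly poly poly \<Rightarrow> real \<times> real \<times> real \<Rightarrow> real" where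
  "eval3 F = (\<lambda>(x, y, z). eval2 (poly F (const2 z)) (x, y))"

definition dx2 :: "real poly poly \<Rightarrow> real poly poly" where
  "dx2 = map_poly pderiv"

definition dy2 :: "real poly poly \<Rightarrow> real poly poly" where
  "dy2 = pderiv"

definition dx3 :: "real poly poly poly \<Rightarrow> real poly poly poly" where
  "dx3 = map_poly dx2"

definition dy3 :: "real poly poly poly \<Rightarrow> real poly poly poly" where
  "dy3 = map_poly dy2"

definition dz3 :: "real poly poly poly \<Rightarrow> real poly poly poly" where
  "dz3 = pderiv"

definition zero_set3 :: "real poly poly poly \<Rightarrow> (real \<times> real \<times> real) set" where
  "zero_set3 F = {p. eval3 F p = 0}"


section \<open>The torus and the quadric\<close>

definition torus_p2 :: "real \<Rightarrow> real \<Rightarrow> real poly poly" where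
  "torus_p2 r R = const2 2 * (const2 (R^2 - r^2) + X2^2 + Y2^2)"

definition torus_p0 :: "real \<Rightarrow> real \<Rightarrow> real poly poly" where
  "torus_p0 r R = (const2 (R^2 + 2 * R * r + r^2) - X2^2 - Y2^2)
                * (const2 (R^2 - 2 * R * r + r^2) - X2^2 - Y2^2)"

definition torus_poly :: "real poly poly \<Rightarrow> real poly poly \<Rightarrow> real poly poly poly" where
  "torus_poly p2 p0 = [:p0, 0, p2, 0, 1:]"

definition quadric_q1 :: "real \<Rightarrow> real \<Rightarrow> real \<Rightarrow> real poly poly" where
  "quadric_q1 e f i = const2 e * X2 + const2 f * Y2 + const2 i"

definition quadric_q0 ::
    "real \<Rightarrow> real \<Rightarrow> real \<Rightarrow> real \<Rightarrow> real \<Rightarrow> real \<Rightarrow> real poly poly" where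
  "quadric_q0 a b d g h j =
     const2 a * X2^2 + const2 b * Y2^2 + const2 d * X2 * Y2 + const2 g * X2 + const2 h * Y2 + const2 j"

definition quadric_poly :: "real poly poly \<Rightarrow> real poly poly \<Rightarrow> real poly poly poly" where
  "quadric_poly q1 q0 = [:q0, q1, 1:]"


section \<open>The plane curve\<close>

definition S0_tilde ::
    "real poly poly \<Rightarrow> real poly poly \<Rightarrow> real poly poly \<Rightarrow> real poly poly \<Rightarrow> real poly poly" where
  "S0_tilde p2 p0 q1 q0 = resultant (torus_poly p2 p0) (quadric_poly q1 q0)"

text \<open>
  The product of the distinct irreducible factors (unique up to a nonzero constant). This is not the
  library's \<^const>\<open>squarefree_part\<close>, which retains only the primes of odd multiplicity.
\<close>

definition sqfree_radical :: "real poly poly \<Rightarrow> real poly poly" where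
  "sqfree_radical P = (if P = 0 then 0 else \<Prod>(prime_factors P))"

definition S0_hat ::
    "real poly poly \<Rightarrow> real poly poly \<Rightarrow> real poly poly \<Rightarrow> real poly poly \<Rightarrow> real poly poly" where
  "S0_hat p2 p0 q1 q0 = sqfree_radical (S0_tilde p2 p0 q1 q0)"

definition S0 ::
    "real poly poly \<Rightarrow> real poly poly \<Rightarrow> real poly poly \<Rightarrow> real poly poly \<Rightarrow> real poly poly" where
  "S0 p2 p0 q1 q0 =
     S0_hat p2 p0 q1 q0 div gcd (S0_hat p2 p0 q1 q0) (p2 + q1^2 - 2 * q0)"

text \<open>The argument \<open>P\<close> is meant to be a squarefree polynomial defining the curve.\<close>

definition plane_curve_singular :: "real poly poly \<Rightarrow> real \<times> real \<Rightarrow> bool" where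
  "plane_curve_singular P p \<longleftrightarrow> eval2 P p = 0 \<and> eval2 (dx2 P) p = 0 \<and> eval2 (dy2 P) p = 0"


section \<open>Singular points of real space curves\<close>

definition vanishing_ideal :: "(real \<times> real \<times> real) set \<Rightarrow> real poly poly poly set" where
  "vanishing_ideal C = {F. \<forall>p\<in>C. eval3 F p = 0}"

text \<open>The ideal generated by \<open>G\<close>: the submodule spanned by \<open>G\<close> in the ring as a module over itself.\<close>

definition ideal_generated :: "'a::comm_ring_1 set \<Rightarrow> 'a set" where
  "ideal_generated G = module.span (*) G"

definition gradient3 ::
    "real poly poly poly \<Rightarrow> real \<times> real \<times> real \<Rightarrow> real \<times> real \<times> real" where
  "gradient3 F p = (eval3 (dx3 F) p, eval3 (dy3 F) p, eval3 (dz3 F) p)"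

text \<open>
  The rows of the Jacobian matrix of \<open>G\<close> at \<open>p\<close> are the gradients of the elements of \<open>G\<close>. As in
  the library definition of \<^const>\<open>rank\<close>, the rank is the dimension of the set of rows; the library
  constant itself does not apply because the number of rows is the size of \<open>G\<close>, which is not a type.
\<close>

definition jacobian_rank :: "real poly poly poly set \<Rightarrow> real \<times> real \<times> real \<Rightarrow> nat" where
  "jacobian_rank G p = dim ((\<lambda>F. gradient3 F p) ` G)"

text \<open>
  The rank does not depend on the choice of the finite generating set, so quantifying existentially
  over it is harmless. Isolated points count as singular whatever the rank (it is 3 at a
  zero-dimensional component).
\<close>

definition space_curve_singular ::
    "(real \<times> real \<times> real) set \<Rightarrow> real \<times> real \<times> real \<Rightarrow> bool" where
  "space_curve_singular C p \<longleftrightarrow>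
     p \<in> C \<and>
     ((\<exists>G. finite G \<and> ideal_generated G = vanishing_ideal C \<and> jacobian_rank G p \<le> 1) \<or>
      p isolated_in C)"


section \<open>The explicit form of the resultant\<close>

definition list_det :: "'a::comm_ring_1 list list \<Rightarrow> 'a" where
  "list_det rs = Determinant.det (Matrix.mat (length rs) (length rs) (\<lambda>(s, t). rs ! s ! t))"

lemma list_det_Nil: "list_det [] = 1"
  by (simp add: list_det_def)

lemma list_det_expand:
  assumes "\<forall>r\<in>set rs. length r = length rs" "rs \<noteq> []"
  shows "list_det rs =
    (\<Sum>k<length rs. (-1)^k * (hd (rs ! k) *
       list_det (map tl (take k rs @ drop (Suc k) rs))))"
proof -
  let ?n = "length rs"
  let ?A = "Matrix.mat ?n ?n (\<lambda>(s, t). rs ! s ! t)"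
  have len: "length (rs ! s) = ?n" if "s < ?n" for s
    using that assms by auto
  have hd: "hd (rs ! s) = rs ! s ! 0" if "s < ?n" for s
    using len[OF that] that by (intro hd_conv_nth) auto
  have del: "mat_delete ?A k 0 = Matrix.mat (?n - 1) (?n - 1)
      (\<lambda>(s, t). map tl (take k rs @ drop (Suc k) rs) ! s ! t)" if "k < ?n" for k
    by (rule eq_matI) (use that len in \<open>auto simp: mat_delete_def nth_append nth_tl min_def\<close>)
  have "list_det rs = (\<Sum>k<?n. ?A $$ (k, 0) * cofactor ?A k 0)"
    unfolding list_det_def by (rule laplace_expansion_column) (use assms in auto)
  also have "\<dots> = (\<Sum>k<?n. (-1)^k * (hd (rs ! k) *
       list_det (map tl (take k rs @ drop (Suc k) rs))))"
    by (rule sum.cong)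
       (use assms in \<open>simp_all add: cofactor_def del list_det_def hd mult.left_commute\<close>)
  finally show ?thesis .
qed

lemma list_det_Cons:
  assumes "\<forall>r\<in>set (a # rs). length r = length (a # rs)"
  shows "list_det (a # rs) =
    (\<Sum>k\<leftarrow>[0..<length (a # rs)]. (-1)^k * (hd ((a # rs) ! k) *
       list_det (map tl (take k (a # rs) @ drop (Suc k) (a # rs)))))"
  using assms
  by (subst list_det_expand) (auto simp: sum_list_distinct_conv_sum_set atLeast0LessThan
      simp del: upt_Suc)

text \<open>
  Multiplication with a congruence rule that delays rewriting of the second factor, so that cofactors
  of zero entries are discarded before they are expanded.
\<close>

definition col_term :: "'a::comm_ring_1 \<Rightarrow> 'a \<Rightarrow> 'a" where
  "col_term a D = a * D"

lemma col_term_cong: "a = a' \<Longrightarrow> col_term a D = col_term a' D"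
  by simp

lemma col_term_simps: "col_term 0 D = 0" "col_term 1 D = D"
  by (simp_all add: col_term_def)

lemma list_det_col_term:
  assumes "\<forall>r\<in>set (a # rs). length r = length (a # rs)"
  shows "list_det (a # rs) =
    (\<Sum>k\<leftarrow>[0..<length (a # rs)]. col_term (hd ((a # rs) ! k))
       ((-1)^k * list_det (map tl (take k (a # rs) @ drop (Suc k) (a # rs)))))"
  unfolding list_det_Cons[OF assms] col_term_def by (simp only: mult.left_commute)

lemma list_det_quartic_quadratic:
  fixes p2 p0 q1 q0 :: "'a::comm_ring_1"
  shows "list_det
   [[1, 0, p2, 0, p0, 0],
    [0, 1, 0, p2, 0, p0],
    [1, q1, q0, 0, 0, 0],
    [0, 1, q1, q0, 0, 0],
    [0, 0, 1, q1, q0, 0],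
    [0, 0, 0, 1, q1, q0]] =
    (q0 * q1^2 + p2 * q0 - q0^2 - p0)^2 + q1^2 * (q1^2 + p2 - 2 * q0) * (p0 - q0^2)"
  (is "_ = ?r")
proof -
  obtain r where r: "r = ?r" by blast
  show ?thesis
    unfolding r[symmetric]
    apply (simp add: list_det_col_term col_term_simps cong: col_term_cong)
    apply (simp add: list_det_col_term col_term_simps list_det_Nil
      col_term_def[of p0] col_term_def[of p2] col_term_def[of q0] col_term_def[of q1]
      cong: col_term_cong)
    apply (simp add: r power2_eq_square left_diff_distrib right_diff_distrib distrib_left distrib_right
      mult_2 ac_simps)
    done
qed

lemma all_less_6_iff: "(\<forall>s<6. P s) \<longleftrightarrow> P 0 \<and> P 1 \<and> P 2 \<and> P 3 \<and> P 4 \<and> P (5::nat)"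
proof -
  have "{..<6::nat} = {0, 1, 2, 3, 4, 5}"
    by (simp add: lessThan_nat_numeral lessThan_Suc insert_commute)
  moreover have "(\<forall>s<6. P s) \<longleftrightarrow> (\<forall>s\<in>{..<6}. P s)"
    by (simp only: lessThan_iff Ball_def)
  ultimately show ?thesis
    by (simp only: ball_simps simp_thms)
qed

lemma sylvester_mat_quartic_quadratic:
  fixes p2 p0 q1 q0 :: "'a::comm_ring_1"
  shows "sylvester_mat [:p0, 0, p2, 0, 1:] [:q0, q1, 1:] =
    Matrix.mat 6 6 (\<lambda>(s, t).
      [[1, 0, p2, 0, p0, 0],
       [0, 1, 0, p2, 0, p0],
       [1, q1, q0, 0, 0, 0],
       [0, 1, q1, q0, 0, 0],
       [0, 0, 1, q1, q0, 0],
       [0, 0, 0, 1, q1, q0]] ! s ! t)" (is "_ = Matrix.mat 6 6 ?F")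
proof -
  let ?p = "[:p0, 0, p2, 0, 1:]"
  let ?q = "[:q0, q1, 1:]"
  have deg: "degree ?p = 4" "degree ?q = 2" by simp_all
  define F where "F = (\<lambda>(s, t).
     if s < 2 then if s \<le> t \<and> t - s \<le> 4 then coeff ?p (4 + s - t) else 0
     else if s - 2 \<le> t \<and> t \<le> s then coeff ?q (s - t) else 0)"
  define G where "G = ?F"
  define P where "P = ?p"
  define Q where "Q = ?q"
  have coeffs: "coeff P 0 = p0" "coeff P (Suc 0) = 0" "coeff P 2 = p2" "coeff P 3 = 0" "coeff P 4 = 1"
    "coeff Q 0 = q0" "coeff Q (Suc 0) = q1" "coeff Q 2 = 1"
    by (simp_all add: P_def Q_def coeff_pCons numeral_eq_Suc)
  have eq: "\<forall>s<6. \<forall>t<6. F (s, t) = G (s, t)"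
    unfolding all_less_6_iff F_def G_def by (simp add: coeffs flip: P_def Q_def)
  have "sylvester_mat ?p ?q = Matrix.mat (4 + 2) (4 + 2) F"
    unfolding sylvester_mat_def sylvester_mat_sub_def deg F_def ..
  also have "\<dots> = Matrix.mat 6 6 G"
    by (rule cong_mat) (use eq in simp_all)
  finally show ?thesis unfolding G_def .
qed

lemma resultant_quartic_quadratic:
  fixes p2 p0 q1 q0 :: "'a::comm_ring_1"
  shows "resultant [:p0, 0, p2, 0, 1:] [:q0, q1, 1:] =
    (q0 * q1^2 + p2 * q0 - q0^2 - p0)^2 + q1^2 * (q1^2 + p2 - 2 * q0) * (p0 - q0^2)"
proof -
  have six: "length [a1, a2, a3, a4, a5, a6] = 6" for a1 a2 a3 a4 a5 a6 :: "'a list"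
    by simp
  show ?thesis
    unfolding resultant_def sylvester_mat_quartic_quadratic
    by (rule list_det_quartic_quadratic[where ?p2.0 = p2 and ?p0.0 = p0 and ?q1.0 = q1 and ?q0.0 = q0,
          unfolded list_det_def six])
qed

lemma S0_tilde_explicit:
  "S0_tilde p2 p0 q1 q0 =
    (q0 * q1^2 + p2 * q0 - q0^2 - p0)^2 + q1^2 * (q1^2 + p2 - 2 * q0) * (p0 - q0^2)"
  unfolding S0_tilde_def torus_poly_def quadric_poly_def by (rule resultant_quartic_quadratic)

end

theory Submission
  imports Defs "HOL-Complex_Analysis.Conformal_Mappings"
begin

text \<open>
  Put \<open>L = p2 + q1\<^sup>2 - 2 q0\<close>. Division of \<open>T\<close> by \<open>Q\<close> leaves a remainder linear in \<open>z\<close>, whose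
  \<open>z\<close>-coefficient is \<open>- q1 L\<close>. Since \<open>r < R\<close>, the polynomial \<open>p2\<close> is positive on the real plane, and
  then \<open>Q\<close> has no real root above a real point where \<open>L\<close> vanishes
  (\<open>real_root_imp_coefficient_nonzero\<close>). Hence \<open>L\<close> is nonzero at \<open>(x0, y0)\<close>, division by the
  greatest common divisor with \<open>L\<close> does not affect singularity there, and the squarefree resultant
  \<open>S\<close> can be studied instead.

  Suppose that \<open>S\<close> has nonzero gradient at \<open>(x0, y0)\<close>; then the space point must be shown regular
  (\<open>singular_point_projects_to_singular_point\<close>). For the rank, \<open>S\<close> lies in the vanishing ideal with a
  horizontal gradient, and a second member of the ideal has a nonzero \<open>z\<close>-derivative: the remainder if
  \<open>q1 (x0, y0) \<noteq> 0\<close>, and \<open>Q\<close> itself, with derivative \<open>2 z0\<close>, otherwise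
  (\<open>jacobian_rank_ge_2\<close>).

  It remains to exclude that the point is isolated. If \<open>q1 (x0, y0) \<noteq> 0\<close>, then \<open>z\<close> is a rational function
  on the smooth plane curve. The delicate case is \<open>q1 (x0, y0) = 0\<close>. Then \<open>z0\<close> and \<open>- z0\<close> are both common
  roots above \<open>(x0, y0)\<close>, and the real arc of the plane curve could a priori lift only to a curve
  through the point at height \<open>- z0\<close>. The value of \<open>T\<close> at the root of \<open>Q\<close> near \<open>z0\<close> is an analytic
  function \<open>h\<close> of \<open>(x, y)\<close>, and all its zeros lie on \<open>S = 0\<close>. Restrict \<open>h\<close> to complex lines normal to the
  curve. On the normal through \<open>(x0, y0)\<close> it has an isolated zero, which persists on neighbouring
  parallel lines and must be the unique point of \<open>S = 0\<close> on them; that point is real because complex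
  conjugation preserves it (\<open>real_zeros_accumulate\<close>). So the arc does lift to points near height
  \<open>z0\<close>.
\<close>

section \<open>Evaluation of bivariate polynomials over real normed fields\<close>

text \<open>
  Evaluation with values in an arbitrary real normed field. The arguments below follow the same
  polynomial from real points, where it is \<^const>\<open>eval2\<close>, to complex points.
\<close>

definition geval :: "real poly poly \<Rightarrow> 'a::real_normed_field \<Rightarrow> 'a \<Rightarrow> 'a" where
  "geval P x y = poly (map_poly (\<lambda>p. poly (map_poly of_real p) x) P) y"

lemma geval_0 [simp]: "geval 0 x y = 0"
  by (simp add: geval_def)

lemma geval_pCons [simp]:
  "geval (pCons a P) x y = poly (map_poly of_real a) x + y * geval P x y"
  by (simp add: geval_def Polynomial.map_poly_pCons)

lemma of_real_poly_add:
  "map_poly (of_real :: real \<Rightarrow> 'a::real_normed_field) (p + q) = map_poly of_real p + map_poly of_real q"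
  by (rule poly_eqI) (simp add: coeff_map_poly)

lemma of_real_poly_mult:
  "map_poly (of_real :: real \<Rightarrow> 'a::real_normed_field) (p * q) = map_poly of_real p * map_poly of_real q"
  by (rule poly_eqI) (simp add: coeff_map_poly coeff_mult)

lemma geval_add [simp]: "geval (P + Q) x y = geval P x y + geval Q x y"
proof (induction P Q rule: poly_induct2)
  case (pCons a P b Q)
  then show ?case by (simp add: of_real_poly_add algebra_simps)
qed simp

lemma geval_smult [simp]: "geval (Polynomial.smult a P) x y = poly (map_poly of_real a) x * geval P x y"
  by (induction P) (auto simp: of_real_poly_mult algebra_simps)

lemma geval_mult [simp]: "geval (P * Q) x y = geval P x y * geval Q x y"
  by (induction P) (simp_all add: mult_pCons_left algebra_simps)

lemma geval_const2 [simp]: "geval (const2 c) x y = of_real c"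
  by (simp add: const2_def Polynomial.map_poly_pCons)

lemma geval_1 [simp]: "geval 1 x y = 1"
  using geval_const2[of 1 x y] by (simp add: const2_def one_pCons)

lemma geval_minus [simp]: "geval (- P) x y = - geval P x y"
  by (metis add.right_inverse geval_0 geval_add minus_unique)

lemma geval_diff [simp]: "geval (P - Q) x y = geval P x y - geval Q x y"
  using geval_add[of P "- Q" x y] by simp

lemma geval_power [simp]: "geval (P ^ n) x y = geval P x y ^ n"
  by (induction n) simp_all

lemma geval_numeral [simp]: "geval (numeral n) x y = numeral n"
proof -
  have "(numeral n :: real poly poly) = const2 (numeral n)"
    by (simp add: const2_def numeral_poly)
  then show ?thesis by (metis geval_const2 of_real_numeral)
qed

lemma geval_prod: "geval (\<Prod>i\<in>I. P i) x y = (\<Prod>i\<in>I. geval (P i) x y)"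
  by (induction I rule: infinite_finite_induct) simp_all

lemma geval_X2 [simp]: "geval X2 x y = x"
  by (simp add: X2_def Polynomial.map_poly_pCons)

lemma geval_Y2 [simp]: "geval Y2 x y = y"
  by (simp add: Y2_def one_pCons Polynomial.map_poly_pCons)

lemma eval2_eq_geval: "eval2 P (x, y) = geval P x y"
proof (induction P)
  case (pCons a P)
  have "map_poly of_real a = a" by (rule poly_eqI) (simp add: coeff_map_poly)
  with pCons show ?case by (simp add: eval2_def)
qed (simp add: eval2_def)

lemma poly_of_real_poly:
  "poly (map_poly of_real p) (of_real x :: 'a::real_normed_field) = of_real (poly p x)"
  by (induction p) (simp_all add: Polynomial.map_poly_pCons)

lemma poly_of_real_poly_cnj: "poly (map_poly of_real p) (cnj x) = cnj (poly (map_poly of_real p) x)"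
  by (induction p) (simp_all add: Polynomial.map_poly_pCons)

lemma geval_of_real:
  "geval P (of_real x) (of_real y) = (of_real (geval P x y) :: 'a::real_normed_field)"
  by (induction P) (simp_all add: poly_of_real_poly)

lemma geval_cnj: "geval P (cnj x) (cnj y) = cnj (geval P x y)"
  by (induction P) (simp_all add: poly_of_real_poly_cnj)

lemma continuous_on_geval [continuous_intros]:
  assumes "continuous_on S u" "continuous_on S v"
  shows "continuous_on S (\<lambda>p. geval P (u p) (v p))"
  using assms by (induction P) (auto intro!: continuous_intros)

lemma isCont_geval: "isCont (\<lambda>p. geval P (fst p) (snd p)) q"
proof -
  have "continuous_on UNIV (\<lambda>p. geval P (fst p) (snd p))"
    by (intro continuous_intros)
  then show ?thesis by (metis continuous_on_eq_continuous_at open_UNIV UNIV_I)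
qed

lemma has_field_derivative_geval [derivative_intros]:
  assumes "(u has_field_derivative u') (at t within S)" "(v has_field_derivative v') (at t within S)"
  shows "((\<lambda>t. geval P (u t) (v t)) has_field_derivative
    u' * geval (dx2 P) (u t) (v t) + v' * geval (dy2 P) (u t) (v t)) (at t within S)"
proof (induction P)
  case 0
  then show ?case by (simp add: dx2_def dy2_def)
next
  case (pCons a P)
  have eq: "map_poly of_real (pderiv a) = pderiv (map_poly of_real a :: 'a poly)"
    by (rule poly_eqI) (simp add: coeff_map_poly coeff_pderiv)
  have "((\<lambda>t. poly (map_poly of_real a) (u t)) has_field_derivative
    u' * poly (map_poly of_real (pderiv a)) (u t)) (at t within S)"
    using DERIV_chain2[OF poly_DERIV assms(1)] by (simp add: eq mult.commute)
  then show ?case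
    by (auto intro!: derivative_eq_intros assms pCons
        simp: dx2_def dy2_def Polynomial.map_poly_pCons pderiv_pCons eq algebra_simps)
qed

lemma geval_dvd: "A dvd B \<Longrightarrow> geval A x y = 0 \<Longrightarrow> geval B x y = 0"
  by (auto elim!: dvdE)

lemma geval_normalize_eq_0_iff: "geval (normalize P) x y = 0 \<longleftrightarrow> geval P x y = 0"
  using geval_dvd[of "normalize P" P] geval_dvd[of P "normalize P"] by auto

text \<open>
  For nonzero \<open>P\<close> both sides hold exactly when some prime factor vanishes. Since complex points are included,
  the explicit resultant can replace its radical in the complex arguments as well.
\<close>

lemma geval_sqfree_radical_eq_0_iff:
  "geval (sqfree_radical P) x y = 0 \<longleftrightarrow> geval P x y = 0"
proof (cases "P = 0")
  case False
  have prod_mset: "geval (prod_mset M) x y = 0 \<longleftrightarrow> (\<exists>p\<in>#M. geval p x y = 0)" for M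
    by (induction M) auto
  have "geval P x y = 0 \<longleftrightarrow> geval (normalize (prod_mset (prime_factorization P))) x y = 0"
    by (simp add: prod_mset_prime_factorization_weak[OF False] geval_normalize_eq_0_iff)
  also have "\<dots> \<longleftrightarrow> (\<exists>p\<in>prime_factors P. geval p x y = 0)"
    by (simp only: geval_normalize_eq_0_iff prod_mset)
  also have "\<dots> \<longleftrightarrow> geval (sqfree_radical P) x y = 0"
    using False by (simp add: sqfree_radical_def geval_prod)
  finally show ?thesis ..
qed (simp add: sqfree_radical_def)


section \<open>Gradients and the rank of the Jacobian\<close>

text \<open>
  Partial derivatives with respect to inner variables act on coefficients, one or two levels down.
  Their Leibniz rules thus follow from the one for polynomials in a single variable.
\<close>

lemma map_poly_derivation_mult:
  fixes D :: "'a::comm_ring_1 \<Rightarrow> 'a"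
  assumes add: "\<And>a b. D (a + b) = D a + D b"
    and mult: "\<And>a b. D (a * b) = D a * b + a * D b"
  shows "map_poly D (P * Q) = map_poly D P * Q + P * map_poly D Q"
proof (rule poly_eqI)
  fix n
  have D0: "D 0 = 0" using add[of 0 0] by simp
  have D_sum: "D (sum g I) = (\<Sum>i\<in>I. D (g i))" for g and I :: "nat set"
    by (induction I rule: infinite_finite_induct) (simp_all add: D0 add)
  show "coeff (map_poly D (P * Q)) n = coeff (map_poly D P * Q + P * map_poly D Q) n"
    by (simp add: coeff_map_poly D0 coeff_mult D_sum mult sum.distrib)
qed

lemma map_poly_additive:
  fixes D :: "'a::comm_ring_1 \<Rightarrow> 'a"
  assumes add: "\<And>a b. D (a + b) = D a + D b"
  shows "map_poly D (P + Q) = map_poly D P + map_poly D Q"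
proof -
  have D0: "D 0 = 0" using add[of 0 0] by simp
  show ?thesis by (rule poly_eqI) (simp add: coeff_map_poly D0 add)
qed

lemma dx2_add: "dx2 (P + Q) = dx2 P + dx2 Q"
  unfolding dx2_def by (rule map_poly_additive) (rule pderiv_add)

lemma dx2_mult: "dx2 (P * Q) = dx2 P * Q + P * dx2 Q"
  unfolding dx2_def
  by (rule map_poly_derivation_mult) (simp_all add: pderiv_add pderiv_mult mult.commute add.commute)

lemma dy2_add: "dy2 (P + Q) = dy2 P + dy2 Q"
  by (simp add: dy2_def pderiv_add)

lemma dy2_mult: "dy2 (P * Q) = dy2 P * Q + P * dy2 Q"
  by (simp add: dy2_def pderiv_mult mult.commute)

lemma d3_add:
  "dx3 (F + G) = dx3 F + dx3 G" "dy3 (F + G) = dy3 F + dy3 G" "dz3 (F + G) = dz3 F + dz3 G"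
  unfolding dx3_def dy3_def dz3_def
  by (intro map_poly_additive dx2_add dy2_add pderiv_add)+

lemma d3_mult:
  "dx3 (F * G) = dx3 F * G + F * dx3 G" "dy3 (F * G) = dy3 F * G + F * dy3 G"
  "dz3 (F * G) = dz3 F * G + F * dz3 G"
  unfolding dx3_def dy3_def dz3_def
  by (intro map_poly_derivation_mult dx2_add dy2_add dx2_mult dy2_mult)+
    (simp add: pderiv_mult mult.commute)

lemma eval3_add: "eval3 (F + G) p = eval3 F p + eval3 G p"
  and eval3_mult: "eval3 (F * G) p = eval3 F p * eval3 G p"
  and eval3_0: "eval3 0 p = 0"
  by (cases p, simp add: eval3_def eval2_eq_geval)+

lemma eval3_pCons: "eval3 (pCons A F) (x, y, z) = geval A x y + z * eval3 F (x, y, z)"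
  by (simp add: eval3_def eval2_eq_geval)

lemma gradient3_add: "gradient3 (F + G) p = gradient3 F p + gradient3 G p"
  by (simp add: gradient3_def d3_add eval3_add)

lemma gradient3_mult:
  "gradient3 (F * G) p = eval3 G p *\<^sub>R gradient3 F p + eval3 F p *\<^sub>R gradient3 G p"
  by (simp add: gradient3_def d3_mult eval3_add eval3_mult)

lemma d2_0 [simp]: "dx2 0 = 0" "dy2 0 = 0"
  by (simp_all add: dx2_def dy2_def)

lemma gradient3_low_degree:
  "gradient3 [:A:] (x, y, z) = (geval (dx2 A) x y, geval (dy2 A) x y, 0)"
  "gradient3 [:A, B:] (x, y, z) =
    (geval (dx2 A) x y + z * geval (dx2 B) x y, geval (dy2 A) x y + z * geval (dy2 B) x y,
     geval B x y)"
  "gradient3 [:A, B, C:] (x, y, z) =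
    (geval (dx2 A) x y + z * geval (dx2 B) x y + z\<^sup>2 * geval (dx2 C) x y,
     geval (dy2 A) x y + z * geval (dy2 B) x y + z\<^sup>2 * geval (dy2 C) x y,
     geval B x y + 2 * z * geval C x y)"
  by (simp_all add: gradient3_def dx3_def dy3_def dz3_def Polynomial.map_poly_pCons pderiv_pCons eval3_pCons eval3_0
      algebra_simps power2_eq_square)

text \<open>
  The generators vanish at \<open>p\<close>. In the Leibniz rule for a combination of generators, the terms that
  differentiate the coefficients therefore disappear. So the rank of the Jacobian of the generators
  bounds the number of independent gradients of any elements of the ideal.
\<close>

lemma gradient3_in_span:
  assumes gen: "ideal_generated G = vanishing_ideal C" and "p \<in> C" and F: "F \<in> vanishing_ideal C"
  shows "gradient3 F p \<in> span ((\<lambda>F. gradient3 F p) ` G)"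
proof -
  interpret M: Modules.module "(*) :: real poly poly poly \<Rightarrow> _"
    by unfold_locales (simp_all add: algebra_simps)
  have G0: "eval3 H p = 0" if "H \<in> G" for H
    using M.span_base[OF that] gen \<open>p \<in> C\<close> by (auto simp: ideal_generated_def vanishing_ideal_def)
  have "F \<in> M.span G" using F gen by (simp add: ideal_generated_def)
  then show ?thesis
  proof (induction rule: M.span_induct_alt)
    case base
    show ?case using gradient3_mult[of 0 0 p] by (simp add: eval3_0 span_zero)
  next
    case (step A H F)
    have "eval3 A p *\<^sub>R gradient3 H p + gradient3 F p \<in> span ((\<lambda>F. gradient3 F p) ` G)"
      by (intro span_add[OF span_scale[OF span_base] step.IH] imageI step.hyps)
    then show ?case by (simp add: gradient3_add gradient3_mult G0[OF step(1)])
  qed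
qed

text \<open>
  A nonzero horizontal gradient, such as that of the equation of a smooth plane curve, is independent
  of every gradient with a nonzero \<open>z\<close>-component.
\<close>

lemma jacobian_rank_ge_2:
  assumes "ideal_generated G = vanishing_ideal C" "p \<in> C"
    and F: "F \<in> vanishing_ideal C" "gradient3 F p = (\<alpha>, \<beta>, 0)" "(\<alpha>, \<beta>) \<noteq> 0"
    and H: "H \<in> vanishing_ideal C" "gradient3 H p = (\<gamma>, \<delta>, \<epsilon>)" "\<epsilon> \<noteq> 0"
  shows "2 \<le> jacobian_rank G p"
proof -
  let ?S = "(\<lambda>F. gradient3 F p) ` G"
  have "(\<gamma>, \<delta>, \<epsilon>) \<notin> span {(\<alpha>, \<beta>, 0)}"
    using H(3) by (auto simp: span_singleton)
  then have ind: "independent {(\<gamma>, \<delta>, \<epsilon>), (\<alpha>, \<beta>, 0)}"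
    using F(3) by (auto simp: independent_insert zero_prod_def)
  have "card {(\<gamma>, \<delta>, \<epsilon>), (\<alpha>, \<beta>, 0)} \<le> dim (span ?S)"
    by (rule independent_card_le_dim[OF _ ind])
      (use gradient3_in_span[OF assms(1,2)] F H in \<open>metis empty_subsetI insert_subset\<close>)
  then show ?thesis using H(3) by (auto simp: jacobian_rank_def dim_span)
qed

section \<open>Persistence of real zeros along a smooth curve\<close>

text \<open>
  Near the origin \<open>f 0\<close> is injective, and zeros of \<open>h 0\<close> are zeros of \<open>f 0\<close>, so the origin is an
  isolated zero of \<open>h 0\<close>. Zeros of holomorphic functions persist under small perturbation, so \<open>h s\<close>
  has a complex zero \<open>t\<close> near the origin for each small \<open>s\<close>. It is the only zero of \<open>f s\<close> there. For
  real \<open>s\<close> the zeros of \<open>f s\<close> are closed under conjugation, so \<open>t\<close> equals its conjugate and is real.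
\<close>

lemma real_zeros_accumulate:
  fixes f f' h :: "complex \<Rightarrow> complex \<Rightarrow> complex"
  assumes "0 < \<rho>"
    and df: "\<And>s t. (f s has_field_derivative f' s t) (at t)"
    and cont_f': "continuous_on UNIV (\<lambda>(s, t). f' s t)" and f'0: "f' 0 0 \<noteq> 0"
    and f_cnj: "\<And>s t. f (of_real s) (cnj t) = cnj (f (of_real s) t)"
    and cont_h: "continuous_on (ball 0 \<rho> \<times> ball 0 \<rho>) (\<lambda>(s, t). h s t)"
    and hol_h: "\<And>s. s \<in> ball 0 \<rho> \<Longrightarrow> h s holomorphic_on ball 0 \<rho>"
    and zeros: "\<And>s t. s \<in> ball 0 \<rho> \<Longrightarrow> t \<in> ball 0 \<rho> \<Longrightarrow> h s t = 0 \<Longrightarrow> f s t = 0"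
    and h0: "h 0 0 = 0"
    and "0 < \<epsilon>"
  shows "\<exists>s t :: real. s \<noteq> 0 \<and> \<bar>s\<bar> < \<epsilon> \<and> \<bar>t\<bar> < \<epsilon> \<and> h (of_real s) (of_real t) = 0"
proof -
  define m where "m = f' 0 0"
  have "m \<noteq> 0" using f'0 by (simp add: m_def)
  have "isCont (\<lambda>(s, t). f' s t) (0, 0)"
    using cont_f' by (simp add: continuous_on_eq_continuous_at)
  then obtain d where "0 < d"
    and d: "\<And>s t. dist (s, t) (0, 0) < d \<Longrightarrow> dist (f' s t) m < norm m / 2"
    unfolding continuous_at_eps_delta using \<open>m \<noteq> 0\<close>
    by (metis (no_types, lifting) case_prod_conv half_gt_zero_iff m_def zero_less_norm_iff)
  have f'_near: "norm (f' s t - m) \<le> norm m / 2" if "norm s < d / 2" "norm t < d / 2" for s t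
  proof -
    have "dist (s, t) (0, 0) \<le> norm s + norm t"
      by (simp add: dist_prod_def sqrt_sum_squares_le_sum)
    also have "\<dots> < d" using that by simp
    finally show ?thesis using d[of s t] by (simp add: dist_norm)
  qed
  \<comment> \<open>Subtracting the linear part leaves a map with Lipschitz constant below the norm of \<open>m\<close>.\<close>
  have inj: "t = u" if "norm s < d / 2" "norm t < d / 2" "norm u < d / 2" "f s t = f s u" for s t u
  proof -
    have "norm ((f s t - m * t) - (f s u - m * u)) \<le> norm m / 2 * norm (t - u)"
    proof (rule field_differentiable_bound[of "ball 0 (d / 2)" "\<lambda>t. f s t - m * t" "\<lambda>t. f' s t - m"])
      show "((\<lambda>t. f s t - m * t) has_field_derivative f' s z - m) (at z within ball 0 (d / 2))" for z
        by (auto intro!: derivative_eq_intros has_field_derivative_at_within[OF df])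
    qed (use that f'_near in auto)
    also have "(f s t - m * t) - (f s u - m * u) = m * (u - t)"
      using that(4) by (simp add: algebra_simps)
    finally have "norm m * norm (u - t) \<le> norm m / 2 * norm (u - t)"
      by (simp add: norm_mult norm_minus_commute)
    then show "t = u" using \<open>m \<noteq> 0\<close> by simp
  qed
  define k where "k = min (min (\<rho> / 2) (d / 3)) (\<epsilon> / 2)"
  have k: "0 < k" "k < \<rho>" "k < d / 2" "k < \<epsilon>"
    using \<open>0 < \<rho>\<close> \<open>0 < d\<close> \<open>0 < \<epsilon>\<close> by (auto simp: k_def)
  have f00: "f 0 0 = 0" using zeros[of 0 0] h0 \<open>0 < \<rho>\<close> by simp
  have h_ne: "h 0 t \<noteq> 0" if "norm t = k" for t
  proof
    assume "h 0 t = 0"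
    then have "f 0 t = 0" using zeros[of 0 t] \<open>0 < \<rho>\<close> that k by simp
    then have "t = 0" using inj[of 0 t 0] f00 that k \<open>0 < d\<close> by simp
    then show False using that k by simp
  qed
  have hcont: "continuous_on (cball 0 k) (h s)" if "norm s < \<rho>" for s
    by (rule holomorphic_on_imp_continuous_on, rule holomorphic_on_subset[OF hol_h])
      (use that k in \<open>auto simp: dist_norm\<close>)
  have "\<exists>t\<in>sphere 0 k. \<forall>u\<in>sphere 0 k. norm (h 0 t) \<le> norm (h 0 u)"
    by (rule continuous_attains_inf)
      (use k \<open>0 < \<rho>\<close> in \<open>auto intro!: continuous_intros continuous_on_subset[OF hcont]\<close>)
  then obtain t1 where "norm t1 = k" and t1: "\<And>u. norm u = k \<Longrightarrow> norm (h 0 t1) \<le> norm (h 0 u)"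
    by auto
  define \<mu> where "\<mu> = norm (h 0 t1)"
  have "0 < \<mu>" using h_ne[OF \<open>norm t1 = k\<close>] by (simp add: \<mu>_def)
  have "continuous_on (ball 0 \<rho> \<times> cball 0 k) (\<lambda>(s, t). h s t)"
    by (rule continuous_on_subset[OF cont_h]) (use k in \<open>auto simp: dist_norm\<close>)
  from continuous_on_prod_compactE[OF this, of 0 "\<mu> / 3"] obtain U where U: "0 \<in> U" "open U"
    and unif: "\<forall>s\<in>U \<inter> ball 0 \<rho>. \<forall>t\<in>cball 0 k. dist (h s t) (h 0 t) \<le> \<mu> / 3"
    using \<open>0 < \<mu>\<close> \<open>0 < \<rho>\<close> by auto
  obtain \<eta> where "0 < \<eta>" "ball 0 \<eta> \<subseteq> U" using U openE by blast
  \<comment> \<open>Closeness to \<open>h 0\<close> makes \<open>h s\<close> smaller at the centre than on the circle of radius \<open>k\<close>, and a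
    holomorphic function with this property has a zero inside.\<close>
  define s where "s = min (\<eta> / 2) k"
  have s: "0 < s" "s < \<eta>" "s \<le> k" using \<open>0 < \<eta>\<close> k by (auto simp: s_def)
  have "complex_of_real s \<in> U \<inter> ball 0 \<rho>" using s k \<open>ball 0 \<eta> \<subseteq> U\<close> by auto
  then have close: "norm (h s t - h 0 t) \<le> \<mu> / 3" if "norm t \<le> k" for t
    using unif that by (auto simp: dist_norm)
  have "norm (h s 0) \<le> \<mu> / 3" using close[of 0] h0 k by simp
  moreover have "2 * \<mu> / 3 \<le> norm (h s t)" if "norm t = k" for t
    using close[of t] t1[OF that] norm_triangle_ineq2[of "h 0 t" "h 0 t - h s t"] that
    by (simp add: \<mu>_def norm_minus_commute)
  ultimately have "norm (h s 0) < norm (h s t)" if "norm t = k" for t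
    using that \<open>0 < \<mu>\<close> by (smt (verit) divide_strict_right_mono)
  moreover have "h s holomorphic_on ball 0 k"
    by (rule holomorphic_on_subset[OF hol_h]) (use s k in auto)
  ultimately obtain t where t: "t \<in> ball 0 k" "h s t = 0"
    using holomorphic_contract_to_zero[of 0 k "h s"] hcont[of s] s k by auto
  have "f s t = 0" using zeros[of s t] t s k by auto
  then have "f s (cnj t) = f s t" using f_cnj[of s t] by simp
  then have "cnj t = t" using inj[of s "cnj t" t] t s k by auto
  then have "t = of_real (Re t)" by (simp add: complex_eq_iff)
  moreover have "\<bar>Re t\<bar> < \<epsilon>" using t k abs_Re_le_cmod[of t] by auto
  ultimately show ?thesis using t s k by (intro exI[of _ s] exI[of _ "Re t"]) auto
qed

text \<open>
  The branch of a quadratic over the plane has the form \<open>A + B \<surd>M\<close>, and \<open>A\<^sup>2 - B\<^sup>2 M\<close> is the product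
  of its two conjugates. If the latter vanishes only on a curve that is smooth at a point, then each
  branch that vanishes at the point vanishes at real points arbitrarily close to it. A statement
  about the product alone would not suffice: the real zeros nearby could all belong to the conjugate
  branch. This is why the complex argument of the preceding lemma is needed.
\<close>

lemma surd_zeros_accumulate:
  fixes x0 y0 :: real
  assumes grad: "geval (dx2 G) x0 y0 \<noteq> 0 \<or> geval (dy2 G) x0 y0 \<noteq> 0"
    and M: "0 < geval M x0 y0"
    and zero: "geval A x0 y0 + geval B x0 y0 * sqrt (geval M x0 y0) = 0"
    and G: "\<And>x y :: complex. geval (A\<^sup>2 - B\<^sup>2 * M) x y = 0 \<Longrightarrow> geval G x y = 0"
    and "0 < \<epsilon>"
  shows "\<exists>x y. (x, y) \<noteq> (x0, y0) \<and> dist (x, y) (x0, y0) < \<epsilon> \<and> 0 < geval M x y \<and>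
    geval A x y + geval B x y * sqrt (geval M x y) = 0"
proof -
  define \<alpha> \<beta> where "\<alpha> = geval (dx2 G) x0 y0" and "\<beta> = geval (dy2 G) x0 y0"
  have \<alpha>\<beta>: "\<alpha> \<noteq> 0 \<or> \<beta> \<noteq> 0" using grad by (simp add: \<alpha>_def \<beta>_def)
  \<comment> \<open>Coordinates \<open>s\<close> along the tangent and \<open>t\<close> along the normal of the curve.\<close>
  define X Y :: "complex \<Rightarrow> complex \<Rightarrow> complex"
    where "X = (\<lambda>s t. of_real x0 - of_real \<beta> * s + of_real \<alpha> * t)"
      and "Y = (\<lambda>s t. of_real y0 + of_real \<alpha> * s + of_real \<beta> * t)"
  define x y :: "real \<Rightarrow> real \<Rightarrow> real"
    where "x = (\<lambda>s t. x0 - \<beta> * s + \<alpha> * t)" and "y = (\<lambda>s t. y0 + \<alpha> * s + \<beta> * t)"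
  have XY_real: "X (of_real s) (of_real t) = of_real (x s t)"
    "Y (of_real s) (of_real t) = of_real (y s t)" for s t
    by (simp_all add: X_def Y_def x_def y_def)
  have XY0: "X 0 0 = of_real x0" "Y 0 0 = of_real y0" by (simp_all add: X_def Y_def)
  have cont [continuous_intros]: "continuous_on S (\<lambda>p. X (u p) (v p))" "continuous_on S (\<lambda>p. Y (u p) (v p))"
    if "continuous_on S u" "continuous_on S v" for S and u v :: "complex \<times> complex \<Rightarrow> complex"
    unfolding X_def Y_def by (intro continuous_intros that)+
  have dX: "(X s has_field_derivative \<alpha>) (at t within S)" for s t S
    unfolding X_def by (auto intro!: derivative_eq_intros)
  have dY: "(Y s has_field_derivative \<beta>) (at t within S)" for s t S
    unfolding Y_def by (auto intro!: derivative_eq_intros)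
  have dP: "((\<lambda>t. geval P (X s t) (Y s t)) has_field_derivative
      \<alpha> * geval (dx2 P) (X s t) (Y s t) + \<beta> * geval (dy2 P) (X s t) (Y s t)) (at t within S)" for P s t S
    by (rule has_field_derivative_geval[OF dX dY])
  have hol: "(\<lambda>t. geval P (X s t) (Y s t)) holomorphic_on S" for P s S
    using dP unfolding holomorphic_on_def field_differentiable_def by blast
  have "open {(s, t). 0 < Re (geval M (X s t) (Y s t))}"
  proof -
    have "continuous_on UNIV (\<lambda>p. Re (geval M (X (fst p) (snd p)) (Y (fst p) (snd p))))"
      by (intro continuous_intros)
    from open_Collect_less[OF continuous_on_const this] show ?thesis by (simp add: case_prod_unfold)
  qed
  moreover have "(0, 0) \<in> {(s, t). 0 < Re (geval M (X s t) (Y s t))}"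
    using M by (simp add: XY0 geval_of_real)
  ultimately obtain U V where UV: "open U" "open V" "0 \<in> U" "0 \<in> V"
    "U \<times> V \<subseteq> {(s, t). 0 < Re (geval M (X s t) (Y s t))}"
    by (rule open_prod_elim) auto
  then obtain u v where "0 < u" "ball 0 u \<subseteq> U" "0 < v" "ball 0 v \<subseteq> V"
    by (meson openE)
  define \<rho> where "\<rho> = min u v"
  have "0 < \<rho>" using \<open>0 < u\<close> \<open>0 < v\<close> by (simp add: \<rho>_def)
  \<comment> \<open>On this bidisc the principal square root of \<open>M\<close> is holomorphic.\<close>
  have M_pos: "0 < Re (geval M (X s t) (Y s t))" if "s \<in> ball 0 \<rho>" "t \<in> ball 0 \<rho>" for s t
    using that UV(5) \<open>ball 0 u \<subseteq> U\<close> \<open>ball 0 v \<subseteq> V\<close> by (auto simp: \<rho>_def subset_iff)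
  then have M_nonpos: "geval M (X s t) (Y s t) \<notin> \<real>\<^sub>\<le>\<^sub>0" if "s \<in> ball 0 \<rho>" "t \<in> ball 0 \<rho>" for s t
    using that by (fastforce simp: complex_nonpos_Reals_iff)
  define h where "h = (\<lambda>s t. geval A (X s t) (Y s t) +
      geval B (X s t) (Y s t) * csqrt (geval M (X s t) (Y s t)))"
  have h_real: "h (of_real s) (of_real t) = of_real (geval A (x s t) (y s t) +
      geval B (x s t) (y s t) * sqrt (geval M (x s t) (y s t)))"
    if "0 < geval M (x s t) (y s t)" for s t
    using that by (simp add: h_def XY_real geval_of_real csqrt_of_real_nonneg)
  \<comment> \<open>The displacement in the plane is at most \<open>K\<close> times the sum of the absolute values of \<open>s\<close> and \<open>t\<close>.\<close>
  define K where "K = \<bar>\<alpha>\<bar> + \<bar>\<beta>\<bar>"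
  have "0 < K" using \<alpha>\<beta> by (auto simp: K_def)
  define \<epsilon>' where "\<epsilon>' = min \<rho> (\<epsilon> / (4 * K))"
  have "0 < \<epsilon>'" using \<open>0 < \<rho>\<close> \<open>0 < \<epsilon>\<close> \<open>0 < K\<close> by (simp add: \<epsilon>'_def)
  have "\<exists>s t :: real. s \<noteq> 0 \<and> \<bar>s\<bar> < \<epsilon>' \<and> \<bar>t\<bar> < \<epsilon>' \<and> h (of_real s) (of_real t) = 0"
  proof (rule real_zeros_accumulate[OF \<open>0 < \<rho>\<close> dP[of G] _ _ _ _ _ _ _ \<open>0 < \<epsilon>'\<close>])
    show "continuous_on UNIV (\<lambda>(s, t). \<alpha> * geval (dx2 G) (X s t) (Y s t) + \<beta> * geval (dy2 G) (X s t) (Y s t))"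
      unfolding case_prod_beta by (intro continuous_intros)
    have "\<alpha> * geval (dx2 G) (X 0 0) (Y 0 0) + \<beta> * geval (dy2 G) (X 0 0) (Y 0 0) = complex_of_real (\<alpha>\<^sup>2 + \<beta>\<^sup>2)"
      unfolding XY0 geval_of_real by (simp add: \<alpha>_def \<beta>_def power2_eq_square)
    moreover have "\<alpha>\<^sup>2 + \<beta>\<^sup>2 \<noteq> 0" using \<alpha>\<beta> by (simp add: sum_power2_eq_zero_iff)
    ultimately show "\<alpha> * geval (dx2 G) (X 0 0) (Y 0 0) + \<beta> * geval (dy2 G) (X 0 0) (Y 0 0) \<noteq> 0"
      by (metis of_real_eq_0_iff)
    show "geval G (X (of_real s) (cnj t)) (Y (of_real s) (cnj t)) =
        cnj (geval G (X (of_real s) t) (Y (of_real s) t))" for s t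
      unfolding geval_cnj[symmetric] by (simp add: X_def Y_def)
    show "continuous_on (ball 0 \<rho> \<times> ball 0 \<rho>) (\<lambda>(s, t). h s t)"
      unfolding h_def case_prod_beta
      using M_nonpos by (intro continuous_intros continuous_on_compose2[OF continuous_on_csqrt]) auto
    show "h s holomorphic_on ball 0 \<rho>" if "s \<in> ball 0 \<rho>" for s
      unfolding h_def using M_nonpos[OF that] by (intro holomorphic_intros hol) auto
    show "geval G (X s t) (Y s t) = 0" if "h s t = 0" for s t
    proof (rule G)
      define w where "w = csqrt (geval M (X s t) (Y s t))"
      have "geval M (X s t) (Y s t) = w\<^sup>2"
        and "h s t = geval A (X s t) (Y s t) + geval B (X s t) (Y s t) * w"
        by (simp_all add: w_def h_def)
      then have "geval (A\<^sup>2 - B\<^sup>2 * M) (X s t) (Y s t) =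
        h s t * (geval A (X s t) (Y s t) - geval B (X s t) (Y s t) * w)"
        by (simp add: algebra_simps power2_eq_square)
      then show "geval (A\<^sup>2 - B\<^sup>2 * M) (X s t) (Y s t) = 0" using that by simp
    qed
    show "h 0 0 = 0"
      using h_real[of 0 0] zero M by (simp add: x_def y_def)
  qed
  then obtain s t :: real where st: "s \<noteq> 0" "\<bar>s\<bar> < \<epsilon>'" "\<bar>t\<bar> < \<epsilon>'" "h (of_real s) (of_real t) = 0"
    by blast
  have "0 < Re (geval M (X (of_real s) (of_real t)) (Y (of_real s) (of_real t)))"
    using st by (intro M_pos) (auto simp: \<epsilon>'_def)
  then have pos: "0 < geval M (x s t) (y s t)" by (simp add: XY_real geval_of_real)
  show ?thesis
  proof (intro exI conjI)
    have "(x s t - x0)\<^sup>2 + (y s t - y0)\<^sup>2 = (s\<^sup>2 + t\<^sup>2) * (\<alpha>\<^sup>2 + \<beta>\<^sup>2)"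
      by (simp add: x_def y_def power2_eq_square algebra_simps)
    moreover have "(s\<^sup>2 + t\<^sup>2) * (\<alpha>\<^sup>2 + \<beta>\<^sup>2) \<noteq> 0"
      using \<alpha>\<beta> \<open>s \<noteq> 0\<close> by (simp add: sum_power2_eq_zero_iff)
    ultimately show "(x s t, y s t) \<noteq> (x0, y0)" by auto
    have le: "\<bar>a * u + b * v\<bar> \<le> (\<bar>a\<bar> + \<bar>b\<bar>) * \<epsilon>'" if "\<bar>u\<bar> < \<epsilon>'" "\<bar>v\<bar> < \<epsilon>'" for a b u v :: real
      using that abs_triangle_ineq[of "a * u" "b * v"]
        mult_left_mono[of "\<bar>u\<bar>" \<epsilon>' "\<bar>a\<bar>"] mult_left_mono[of "\<bar>v\<bar>" \<epsilon>' "\<bar>b\<bar>"]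
      by (simp add: abs_mult algebra_simps)
    have "dist (x s t, y s t) (x0, y0) \<le> \<bar>x s t - x0\<bar> + \<bar>y s t - y0\<bar>"
      by (simp add: dist_prod_def dist_real_def sqrt_sum_squares_le_sum_abs[of "x s t - x0", simplified])
    also have "\<dots> \<le> 2 * (K * \<epsilon>')"
      using le[OF st(3) st(2), of \<alpha> "-\<beta>"] le[OF st(2) st(3), of \<alpha> \<beta>] by (simp add: x_def y_def K_def)
    also have "\<dots> \<le> 2 * (K * (\<epsilon> / (4 * K)))"
      using \<open>0 < K\<close> by (intro mult_left_mono) (auto simp: \<epsilon>'_def)
    also have "\<dots> < \<epsilon>" using \<open>0 < K\<close> \<open>0 < \<epsilon>\<close> by simp
    finally show "dist (x s t, y s t) (x0, y0) < \<epsilon>" .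
    show "geval A (x s t) (y s t) + geval B (x s t) (y s t) * sqrt (geval M (x s t) (y s t)) = 0"
      using st(4) unfolding h_real[OF pos] of_real_eq_0_iff .
  qed (rule pos)
qed

text \<open>
  The form used for space curves: \<open>\<zeta>\<close> is a continuous section that lifts the zeros of the branch to
  points of \<open>C\<close>.
\<close>

lemma not_isolated_over_surd:
  fixes x0 y0 :: real and \<zeta> :: "real \<times> real \<Rightarrow> real"
  assumes grad: "geval (dx2 G) x0 y0 \<noteq> 0 \<or> geval (dy2 G) x0 y0 \<noteq> 0"
    and M: "0 < geval M x0 y0"
    and zero: "geval A x0 y0 + geval B x0 y0 * sqrt (geval M x0 y0) = 0"
    and G: "\<And>x y :: complex. geval (A\<^sup>2 - B\<^sup>2 * M) x y = 0 \<Longrightarrow> geval G x y = 0"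
    and cont: "isCont \<zeta> (x0, y0)"
    and lift: "\<forall>\<^sub>F (x, y) in nhds (x0, y0).
      0 < geval M x y \<longrightarrow> geval A x y + geval B x y * sqrt (geval M x y) = 0 \<longrightarrow> (x, y, \<zeta> (x, y)) \<in> C"
  shows "\<not> (x0, y0, \<zeta> (x0, y0)) isolated_in C"
proof
  assume "(x0, y0, \<zeta> (x0, y0)) isolated_in C"
  then obtain e where "0 < e"
    and e: "\<And>q. q \<in> C \<Longrightarrow> dist (x0, y0, \<zeta> (x0, y0)) q < e \<Longrightarrow> q = (x0, y0, \<zeta> (x0, y0))"
    unfolding isolated_in_dist_Ex_iff by blast
  have "isCont (\<lambda>p. (fst p, snd p, \<zeta> p)) (x0, y0)"
    by (intro continuous_intros cont)
  then obtain d1 where "0 < d1"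
    and d1: "\<And>x y. dist (x, y) (x0, y0) < d1 \<Longrightarrow> dist (x, y, \<zeta> (x, y)) (x0, y0, \<zeta> (x0, y0)) < e"
    unfolding continuous_at_eps_delta using \<open>0 < e\<close> by fastforce
  obtain d2 where "0 < d2" and d2: "\<And>x y. dist (x, y) (x0, y0) < d2 \<Longrightarrow> 0 < geval M x y \<Longrightarrow>
      geval A x y + geval B x y * sqrt (geval M x y) = 0 \<Longrightarrow> (x, y, \<zeta> (x, y)) \<in> C"
    using lift unfolding eventually_nhds_metric by fastforce
  obtain x y where "(x, y) \<noteq> (x0, y0)" "dist (x, y) (x0, y0) < min d1 d2" "0 < geval M x y"
    "geval A x y + geval B x y * sqrt (geval M x y) = 0"
    using surd_zeros_accumulate[OF grad M zero G, of "min d1 d2"] \<open>0 < d1\<close> \<open>0 < d2\<close> by auto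
  then show False using e[of "(x, y, \<zeta> (x, y))"] d1[of x y] d2[of x y] by (auto simp: dist_commute)
qed

section \<open>Projection of singular points\<close>

lemma eval3_torus_quadric:
  "eval3 (torus_poly p2 p0) (x, y, z) = z ^ 4 + geval p2 x y * z\<^sup>2 + geval p0 x y"
  "eval3 (quadric_poly q1 q0) (x, y, z) = z\<^sup>2 + geval q1 x y * z + geval q0 x y"
  by (simp_all add: torus_poly_def quadric_poly_def eval3_pCons eval3_0 algebra_simps
      power2_eq_square power4_eq_xxxx)

text \<open>
  If \<open>2 r = P + q\<^sup>2\<close>, the discriminant \<open>q\<^sup>2 - 4 r\<close> of the quadratic is \<open>- q\<^sup>2 - 2 P\<close>, which is negative.
\<close>

lemma real_root_imp_coefficient_nonzero:
  fixes P q r z :: real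
  assumes "z\<^sup>2 + q * z + r = 0" "0 < P"
  shows "P + q\<^sup>2 - 2 * r \<noteq> 0"
proof
  assume "P + q\<^sup>2 - 2 * r = 0"
  then have "(2 * z + q)\<^sup>2 + q\<^sup>2 + 2 * P = 4 * (z\<^sup>2 + q * z + r)"
    by (simp add: power2_eq_square algebra_simps)
  then show False using assms by (smt (verit) zero_le_power2)
qed

text \<open>
  With \<open>L = p2 + q1\<^sup>2 - 2 q0\<close> and \<open>N\<close> as in the proof, the remainder of the quartic modulo the
  quadratic is \<open>- (q1 L z + N)\<close>. So the space curve is given by the quadratic and the equation
  \<open>q1 L z + N = 0\<close>, and the resultant is the product of \<open>q1 L z + N\<close> over the two roots of the
  quadratic. If the plane curve were smooth at the projected point, the point would be regular and
  not isolated: if \<open>q1\<close> is nonzero there, the linear equation determines \<open>z\<close>; if \<open>q1\<close> vanishes, the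
  roots of the quadratic are \<open>z0\<close> and \<open>- z0\<close>, which are distinct, so the quadratic itself determines
  \<open>z\<close> as a smooth function of the plane coordinates.
\<close>

lemma singular_point_projects_to_singular_point:
  fixes p2 p0 q1 q0 :: "real poly poly"
  defines "C \<equiv> zero_set3 (torus_poly p2 p0) \<inter> zero_set3 (quadric_poly q1 q0)"
    and "S \<equiv> S0_hat p2 p0 q1 q0"
  assumes sing: "space_curve_singular C (x0, y0, z0)" and "z0 \<noteq> 0"
    and L0: "geval (p2 + q1\<^sup>2 - 2 * q0) x0 y0 \<noteq> 0"
  shows "plane_curve_singular S (x0, y0)"
proof -
  define L where "L = p2 + q1\<^sup>2 - 2 * q0"
  define N where "N = q0 * q1\<^sup>2 + p2 * q0 - q0\<^sup>2 - p0"
  have N_L: "N = q0 * L + q0\<^sup>2 - p0" by (simp add: N_def L_def algebra_simps power2_eq_square)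
  have S_iff: "geval S x y = 0 \<longleftrightarrow> geval (N\<^sup>2 + q1\<^sup>2 * L * (q0 * L - N)) x y = 0"
    for x y :: "'a::real_normed_field"
  proof -
    have "S0_tilde p2 p0 q1 q0 = N\<^sup>2 + q1\<^sup>2 * L * (q0 * L - N)"
    proof -
      have "q1\<^sup>2 + p2 - 2 * q0 = L" "p0 - q0\<^sup>2 = q0 * L - N"
        by (simp_all add: L_def N_L)
      then show ?thesis by (simp only: S0_tilde_explicit N_def)
    qed
    then show ?thesis by (simp only: S_def S0_hat_def geval_sqfree_radical_eq_0_iff)
  qed
  have division: "eval3 (torus_poly p2 p0) (x, y, z) =
      eval3 (quadric_poly q1 q0) (x, y, z) *
        (z\<^sup>2 - geval q1 x y * z + geval p2 x y + (geval q1 x y)\<^sup>2 - geval q0 x y) -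
      (geval q1 x y * geval L x y * z + geval N x y)" for x y z
    unfolding eval3_torus_quadric L_def N_def
    by (simp add: algebra_simps power2_eq_square power4_eq_xxxx)
  have C_iff: "(x, y, z) \<in> C \<longleftrightarrow> z\<^sup>2 + geval q1 x y * z + geval q0 x y = 0 \<and>
      geval q1 x y * geval L x y * z + geval N x y = 0" for x y z
    by (auto simp: C_def zero_set3_def division eval3_torus_quadric(2))
  have inC: "(x0, y0, z0) \<in> C" using sing by (simp add: space_curve_singular_def)
  have S_on_C: "geval S x y = 0" if "(x, y, z) \<in> C" for x y z
  proof -
    define a b l n where "a = geval q1 x y" "b = geval q0 x y" "l = geval L x y" "n = geval N x y"
    have "z\<^sup>2 + a * z + b = 0" "n = - (a * l * z)" using that by (auto simp: C_iff a_b_l_n_def)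
    moreover have "(a * l * z)\<^sup>2 + a\<^sup>2 * l * (b * l + a * l * z) = a\<^sup>2 * l\<^sup>2 * (z\<^sup>2 + a * z + b)"
      by (simp add: algebra_simps power2_eq_square)
    ultimately show ?thesis by (simp add: S_iff flip: a_b_l_n_def)
  qed
  show ?thesis
  proof (rule ccontr)
    assume "\<not> plane_curve_singular S (x0, y0)"
    then have grad: "geval (dx2 S) x0 y0 \<noteq> 0 \<or> geval (dy2 S) x0 y0 \<noteq> 0"
      using S_on_C[OF inC] by (auto simp: plane_curve_singular_def eval2_eq_geval)
    have S_ideal: "[:S:] \<in> vanishing_ideal C"
      using S_on_C by (auto simp: vanishing_ideal_def eval3_pCons eval3_0)
    have rank: "\<not> jacobian_rank G (x0, y0, z0) \<le> 1"
      if "ideal_generated G = vanishing_ideal C"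
        and "H \<in> vanishing_ideal C" "gradient3 H (x0, y0, z0) = (u, v, w)" "w \<noteq> 0" for G H u v w
      using jacobian_rank_ge_2[OF that(1) inC S_ideal _ _ that(2-4)] grad
      by (fastforce simp: gradient3_low_degree zero_prod_def)
    show False
    proof (cases "geval q1 x0 y0 = 0")
      case False
      \<comment> \<open>The curve is locally the graph of \<open>- N / (q1 L)\<close> over the plane curve. The surd is trivial here.\<close>
      have "[:N, q1 * L:] \<in> vanishing_ideal C"
        by (auto simp: vanishing_ideal_def eval3_pCons eval3_0 C_iff algebra_simps)
      then have "\<not> jacobian_rank G (x0, y0, z0) \<le> 1"
        if "ideal_generated G = vanishing_ideal C" for G
        by (rule rank[OF that _ gradient3_low_degree(2)]) (use False L0 in \<open>simp add: L_def\<close>)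
      then have iso: "(x0, y0, z0) isolated_in C"
        using sing by (auto simp: space_curve_singular_def)
      define \<zeta> :: "real \<times> real \<Rightarrow> real"
        where "\<zeta> = (\<lambda>p. - geval N (fst p) (snd p) / geval (q1 * L) (fst p) (snd p))"
      have ne: "geval (q1 * L) x0 y0 \<noteq> 0" using False L0 by (simp add: L_def)
      have "isCont \<zeta> (x0, y0)"
        unfolding \<zeta>_def using ne by (intro continuous_intros isCont_geval) auto
      moreover have "\<forall>\<^sub>F (x, y) in nhds (x0, y0). 0 < geval 1 x y \<longrightarrow>
          geval S x y + geval 0 x y * sqrt (geval 1 x y) = 0 \<longrightarrow> (x, y, \<zeta> (x, y)) \<in> C"
      proof -
        have "open {p. geval (q1 * L) (fst p) (snd p) \<noteq> (0 :: real)}"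
          by (intro open_Collect_neq continuous_intros)
        then have "\<forall>\<^sub>F p in nhds (x0, y0). p \<in> {p. geval (q1 * L) (fst p) (snd p) \<noteq> 0}"
          using ne by (intro eventually_nhds_in_open) auto
        then show ?thesis
        proof eventually_elim
          case (elim p)
          obtain x y where p: "p = (x, y)" by (cases p)
          have "(x, y, \<zeta> (x, y)) \<in> C" if S: "geval S x y = 0"
          proof -
            define a b l n where "a = geval q1 x y" "b = geval q0 x y" "l = geval L x y" "n = geval N x y"
            have al: "a \<noteq> 0" "l \<noteq> 0" using elim by (simp_all add: p a_b_l_n_def)
            have \<zeta>: "\<zeta> (x, y) = - n / (a * l)" by (simp add: \<zeta>_def a_b_l_n_def)
            have "(\<zeta> (x, y))\<^sup>2 + a * \<zeta> (x, y) + b = (n\<^sup>2 + a\<^sup>2 * l * (b * l - n)) / (a * l)\<^sup>2"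
              unfolding \<zeta> using al by (simp add: field_simps power2_eq_square)
            also have "\<dots> = 0" using S by (simp add: S_iff a_b_l_n_def)
            finally show ?thesis
              using al by (simp add: C_iff \<zeta> flip: a_b_l_n_def)
          qed
          then show ?case by (simp add: p)
        qed
      qed
      ultimately have "\<not> (x0, y0, \<zeta> (x0, y0)) isolated_in C"
        using S_on_C[OF inC]
        by (intro not_isolated_over_surd[OF grad, of 1 S 0]) simp_all
      moreover have "\<zeta> (x0, y0) = z0"
        using inC ne by (simp add: \<zeta>_def C_iff field_simps)
      ultimately show False using iso by simp
    next
      case True
      \<comment> \<open>Both points \<open>\<plusminus> z0\<close> lie on the space curve, and the sign of \<open>z0\<close> selects the root of the quadratic
        that passes through the given one. Along that root, \<open>q1 L z + N\<close> is \<open>A + B \<surd>M\<close>.\<close>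
      have "quadric_poly q1 q0 \<in> vanishing_ideal C"
        by (auto simp: vanishing_ideal_def C_def zero_set3_def)
      then have "\<not> jacobian_rank G (x0, y0, z0) \<le> 1"
        if "ideal_generated G = vanishing_ideal C" for G
        by (rule rank[OF that _ gradient3_low_degree(3)[of q0 q1 1, folded quadric_poly_def]])
          (use True \<open>z0 \<noteq> 0\<close> in simp)
      then have iso: "(x0, y0, z0) isolated_in C"
        using sing by (auto simp: space_curve_singular_def)
      define A B M where "A = N - const2 (1/2) * q1\<^sup>2 * L" and "B = const2 (sgn z0) * q1 * L"
        and "M = const2 (1/4) * q1\<^sup>2 - q0"
      define \<zeta> :: "real \<times> real \<Rightarrow> real"
        where "\<zeta> = (\<lambda>p. - (1/2) * geval q1 (fst p) (snd p) + sgn z0 * sqrt (geval M (fst p) (snd p)))"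
      have sgn: "(sgn z0)\<^sup>2 = 1" using \<open>z0 \<noteq> 0\<close> by (simp add: sgn_if)
      have root: "z0\<^sup>2 = - geval q0 x0 y0" using inC True by (simp add: C_iff)
      have M0: "geval M x0 y0 = z0\<^sup>2" using True root by (simp add: M_def)
      have \<zeta>0: "\<zeta> (x0, y0) = z0" by (simp add: \<zeta>_def True M0 sgn_mult_abs)
      have "isCont \<zeta> (x0, y0)" unfolding \<zeta>_def by (intro continuous_intros isCont_geval)
      moreover have "(x, y, \<zeta> (x, y)) \<in> C"
        if "0 < geval M x y" "geval A x y + geval B x y * sqrt (geval M x y) = 0" for x y
      proof -
        define m where "m = sqrt (geval M x y)"
        have "m\<^sup>2 = (geval q1 x y)\<^sup>2 / 4 - geval q0 x y" using that(1) by (simp add: m_def M_def)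
        moreover have "\<zeta> (x, y) = - geval q1 x y / 2 + sgn z0 * m" by (simp add: \<zeta>_def m_def)
        moreover have "(- a / 2 + s * m)\<^sup>2 + a * (- a / 2 + s * m) + b = s\<^sup>2 * m\<^sup>2 - a\<^sup>2 / 4 + b" for a b s :: real
          by (simp add: algebra_simps power2_eq_square)
        moreover have "geval q1 x y * geval L x y * (- geval q1 x y / 2 + sgn z0 * m) + geval N x y =
            geval A x y + geval B x y * m"
          by (simp add: A_def B_def algebra_simps power2_eq_square)
        ultimately show ?thesis using that(2) by (simp add: C_iff sgn flip: m_def)
      qed
      moreover have "geval S x y = 0" if "geval (A\<^sup>2 - B\<^sup>2 * M) x y = 0" for x y :: complex
      proof -
        have s: "complex_of_real (sgn z0) ^ 2 = 1" using sgn by (metis of_real_1 of_real_power)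
        have "geval (A\<^sup>2 - B\<^sup>2 * M) x y = geval (N\<^sup>2 + q1\<^sup>2 * L * (q0 * L - N)) x y"
          using s by (simp add: A_def B_def M_def power_mult_distrib) (simp add: field_simps power2_eq_square)
        then show ?thesis using that by (simp only: S_iff)
      qed
      moreover have "geval A x0 y0 + geval B x0 y0 * sqrt (geval M x0 y0) = 0"
        using inC True by (simp add: A_def B_def C_iff)
      ultimately have "\<not> (x0, y0, \<zeta> (x0, y0)) isolated_in C"
        using M0 \<open>z0 \<noteq> 0\<close>
        by (intro not_isolated_over_surd[OF grad, of M A B]) (auto intro!: always_eventually)
      then show False using iso \<zeta>0 by simp
    qed
  qed
qed

theorem theorem3p8:
  fixes r R a b d e f g h i j x0 y0 z0 :: real
    and p2 p0 q1 q0 :: "real poly poly"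
    and T Q :: "real poly poly poly"
  assumes "0 < r" and "r < R"
    and p2: "p2 = torus_p2 r R"
    and p0: "p0 = torus_p0 r R"
    and q1: "q1 = quadric_q1 e f i"
    and q0: "q0 = quadric_q0 a b d g h j"
    and T: "T = torus_poly p2 p0"
    and Q: "Q = quadric_poly q1 q0"
    and irred: "irreducible Q"
    and sing: "space_curve_singular (zero_set3 T \<inter> zero_set3 Q) (x0, y0, z0)"
    and "z0 \<noteq> 0"
  shows "plane_curve_singular (S0 p2 p0 q1 q0) (x0, y0)"
proof -
  define S D where "S = S0_hat p2 p0 q1 q0" and "D = gcd S (p2 + q1\<^sup>2 - 2 * q0)"
  have inC: "eval3 (torus_poly p2 p0) (x0, y0, z0) = 0" "eval3 (quadric_poly q1 q0) (x0, y0, z0) = 0"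
    using sing by (simp_all add: space_curve_singular_def zero_set3_def T Q)
  have "r\<^sup>2 < R\<^sup>2" using \<open>0 < r\<close> \<open>r < R\<close> by (simp add: power_strict_mono)
  then have "0 < geval p2 x0 y0"
    by (simp add: p2 torus_p2_def) (smt (verit) zero_le_power2)
  then have L0: "geval (p2 + q1\<^sup>2 - 2 * q0) x0 y0 \<noteq> 0"
    using real_root_imp_coefficient_nonzero[of z0 "geval q1 x0 y0" "geval q0 x0 y0" "geval p2 x0 y0"] inC(2)
    by (simp add: eval3_torus_quadric)
  then have D0: "geval D x0 y0 \<noteq> 0"
    using geval_dvd[of D "p2 + q1\<^sup>2 - 2 * q0" x0 y0] by (auto simp: D_def)
  have S_eq: "S = S0 p2 p0 q1 q0 * D" by (simp add: S0_def S_def D_def)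
  have S_sing: "geval S x0 y0 = 0" "geval (dx2 S) x0 y0 = 0" "geval (dy2 S) x0 y0 = 0"
    using singular_point_projects_to_singular_point[OF sing[unfolded T Q] \<open>z0 \<noteq> 0\<close> L0]
    by (simp_all add: S_def plane_curve_singular_def eval2_eq_geval)
  with S_eq D0 have S0_0: "geval (S0 p2 p0 q1 q0) x0 y0 = 0" by simp
  with S_sing D0 have "geval (dx2 (S0 p2 p0 q1 q0)) x0 y0 = 0" "geval (dy2 (S0 p2 p0 q1 q0)) x0 y0 = 0"
    by (simp_all add: S_eq dx2_mult dy2_mult)
  with S0_0 show ?thesis by (simp add: plane_curve_singular_def eval2_eq_geval)
qed

end
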